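(* Let $n_0,n_1$ be positive integers and $X=[n_0;n_1]=n_0+\tfrac{1}{n_1}$. Then $$\mathrm{F}([n_0;n_1]) = F_{n_0}F_{n_1}+F_{n_0-1}F_{n_1+1}.$$
   Context: The conumerator function is the unique map $\mathrm{con}:\mathbb{Q}_{>0}\to\mathbb{Z}_{>0}$ with $\mathrm{con}(1)=1$ and, for all $X\in\mathbb{Q}_{>0}$, $\mathrm{con}(1+X)=\mathrm{con}(X)+\mathrm{con}(1/X)$ and $\mathrm{con}\left(\tfrac{1}{1+X}\right)=\mathrm{con}(X)$. The codenominator function is $\mathrm{F}(X):=\mathrm{con}(1/X)$ for $X\in\mathbb{Q}_{>0}$; equivalently $\mathrm{F}(1)=1$, $\mathrm{F}(1+X)=\mathrm{F}(1/X)$, $\mathrm{F}\left(\tfrac{1}{1+X}\right)=\mathrm{F}(X)+\mathrm{F}(1/X)$. The Fibonacci numbers are $F_0=0$, $F_1=1$, $F_n=F_{n-1}+F_{n-2}$. *)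

theory Defs
  imports "HOL-Number_Theory.Fib" "HOL-Library.FuncSet"
begin

definition is_conumerator :: "(rat \<Rightarrow> nat) \<Rightarrow> bool" where
  "is_conumerator c \<longleftrightarrow>
     c \<in> {0<..} \<rightarrow> {0<..} \<and>
     c 1 = 1 \<and>
     (\<forall>X>0. c (1 + X) = c X + c (1 / X)) \<and>
     (\<forall>X>0. c (1 / (1 + X)) = c X)"

text \<open>The type \<^typ>\<open>rat\<close> also contains the non-positive rationals, so the uniqueness below needs a
  fixed value there; membership in \<^const>\<open>extensional\<close> makes it \<^const>\<open>undefined\<close>.\<close>

definition con :: "rat \<Rightarrow> nat" where
  "con = (THE c. c \<in> extensional {0<..} \<and> is_conumerator c)"

definition codenominator :: "rat \<Rightarrow> nat" where
  "codenominator X = con (1 / X)"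


subsection \<open>Existence and uniqueness of the conumerator\<close>

definition rat_height :: "rat \<Rightarrow> nat" where
  "rat_height x = nat (fst (quotient_of x) + snd (quotient_of x))"

lemma rat_height_le:
  assumes "a > 0" "b > 0"
  shows "rat_height (of_int a / of_int b) \<le> nat (a + b)"
proof -
  have "quotient_of (Fract a b) = (a div gcd a b, b div gcd a b)"
    using assms by (simp add: quotient_of_Fract Rat.normalize_def Let_def)
  moreover have "a div gcd a b \<le> a" "b div gcd a b \<le> b"
    using assms by (metis dvd_div_mult_self dvd_triv_left gcd_dvd1 zdvd_imp_le,
        metis dvd_div_mult_self dvd_triv_left gcd_dvd2 zdvd_imp_le)
  ultimately show ?thesis
    by (simp add: rat_height_def Fract_of_int_quotient)
qed

lemma rat_posE:
  assumes "(x::rat) > 0"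
  obtains a b where "a > 0" "b > 0" "x = of_int a / of_int b" "rat_height x = nat (a + b)"
proof -
  obtain a b where ab: "quotient_of x = (a, b)" by force
  have b: "b > 0" using quotient_of_denom_pos[OF ab] .
  have x: "x = of_int a / of_int b" using quotient_of_div[OF ab] .
  have "a > 0" using assms b x by (simp add: zero_less_divide_iff)
  then show ?thesis using that b x ab by (simp add: rat_height_def)
qed

lemma rat_height_decrease:
  assumes "(X::rat) > 0"
  shows "rat_height X < rat_height (1 + X)" "rat_height (1 / X) < rat_height (1 + X)"
    "rat_height X < rat_height (1 / (1 + X))"
proof -
  have "1 + X > 0" using assms by simp
  then obtain a b where *: "a > 0" "b > 0" "1 + X = of_int a / of_int b"
      "rat_height (1 + X) = nat (a + b)" by (rule rat_posE)
  have X: "X = of_int (a - b) / of_int b" using * by (simp add: field_simps)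
  have "a - b > 0" using assms X * by (simp add: zero_less_divide_iff)
  have h1: "rat_height X \<le> nat (a - b + b)"
    unfolding X using \<open>a - b > 0\<close> * by (intro rat_height_le)
  have "1 / X = of_int b / of_int (a - b)" using X by simp
  then have h2: "rat_height (1 / X) \<le> nat (b + (a - b))"
    using \<open>a - b > 0\<close> * by (simp only: rat_height_le)
  show "rat_height X < rat_height (1 + X)" "rat_height (1 / X) < rat_height (1 + X)"
    using h1 h2 * by simp_all
  have "1 / (1 + X) > 0" using assms by simp
  then obtain c d where **: "c > 0" "d > 0" "1 / (1 + X) = of_int c / of_int d"
      "rat_height (1 / (1 + X)) = nat (c + d)" by (rule rat_posE)
  have "1 + X = 1 / (1 / (1 + X))" by simp
  also have "\<dots> = of_int d / of_int c" unfolding **(3) by simp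
  finally have X': "X = of_int (d - c) / of_int c" using ** by (simp add: field_simps)
  have "d - c > 0" using assms X' ** by (simp add: zero_less_divide_iff)
  have "rat_height X \<le> nat (d - c + c)"
    unfolding X' using \<open>d - c > 0\<close> ** by (intro rat_height_le)
  then show "rat_height X < rat_height (1 / (1 + X))" using ** by simp
qed

lemma rat_pos_cases [consumes 1, case_names one gt lt]:
  assumes "(x::rat) > 0"
  obtains "x = 1" | X where "X > 0" "x = 1 + X" | X where "X > 0" "x = 1 / (1 + X)"
proof -
  consider "x = 1" | "x > 1" | "x < 1" by linarith
  then show ?thesis
  proof cases
    case 2 then show ?thesis using that(2)[of "x - 1"] by simp
  next
    case 3
    then have "1 / x - 1 > 0" using assms by simp
    moreover have "x = 1 / (1 + (1 / x - 1))" by simp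
    ultimately show ?thesis using that(3) by blast
  qed (use that in blast)
qed

lemma rat_pos_induct [consumes 1, case_names one gt lt]:
  assumes "(x::rat) > 0"
    and "P 1"
    and "\<And>X. X > 0 \<Longrightarrow> P X \<Longrightarrow> P (1 / X) \<Longrightarrow> P (1 + X)"
    and "\<And>X. X > 0 \<Longrightarrow> P X \<Longrightarrow> P (1 / (1 + X))"
  shows "P x"
  using assms(1)
proof (induction x rule: measure_induct_rule[where f = rat_height])
  case (less x)
  from less.prems show ?case
  proof (cases x rule: rat_pos_cases)
    case one then show ?thesis using assms(2) by simp
  next
    case (gt X) then show ?thesis using less.IH[of X] less.IH[of "1 / X"] assms(3)
      rat_height_decrease[of X] by auto
  next
    case (lt X) then show ?thesis using less.IH[of X] assms(4) rat_height_decrease[of X] by auto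
  qed
qed

function con_rec :: "rat \<Rightarrow> nat" where
  "con_rec x =
     (if x \<le> 0 then undefined else if x = 1 then 1
      else if x > 1 then con_rec (x - 1) + con_rec (1 / (x - 1))
      else con_rec (1 / x - 1))"
  by auto
termination
proof (relation "measure rat_height")
  fix x :: rat
  assume "\<not> x \<le> 0" "x \<noteq> 1" "\<not> 1 < x"
  then show "(1 / x - 1, x) \<in> measure rat_height"
    using rat_height_decrease(3)[of "1 / x - 1"] by simp
next
  fix x :: rat
  assume "1 < x"
  then show "(x - 1, x) \<in> measure rat_height" "(1 / (x - 1), x) \<in> measure rat_height"
    using rat_height_decrease(1,2)[of "x - 1"] by simp_all
qed simp

declare con_rec.simps [simp del]

lemma con_rec_one: "con_rec 1 = 1"
  by (simp add: con_rec.simps)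

lemma con_rec_gt: "X > 0 \<Longrightarrow> con_rec (1 + X) = con_rec X + con_rec (1 / X)"
  by (subst con_rec.simps) simp

lemma con_rec_lt: "X > 0 \<Longrightarrow> con_rec (1 / (1 + X)) = con_rec X"
  by (subst con_rec.simps) (auto simp: field_simps)

lemma is_conumerator_con_rec: "is_conumerator con_rec"
proof -
  have "con_rec x > 0" if "x > 0" for x
    using that by (induction x rule: rat_pos_induct)
      (simp_all only: con_rec_one con_rec_gt con_rec_lt)
  then show ?thesis
    by (auto simp: is_conumerator_def con_rec_one con_rec_gt con_rec_lt)
qed

lemma is_conumerator_unique:
  assumes "is_conumerator c" "is_conumerator d" "x > 0"
  shows "c x = d x"
  using assms(3)
  by (induction x rule: rat_pos_induct) (use assms(1,2) in \<open>simp_all only: is_conumerator_def\<close>)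

theorem ex1_conumerator: "\<exists>!c. c \<in> extensional {0<..} \<and> is_conumerator c"
proof (rule ex_ex1I)
  have "con_rec \<in> extensional {0<..}"
    by (auto simp: extensional_def con_rec.simps)
  then show "\<exists>c. c \<in> extensional {0<..} \<and> is_conumerator c"
    using is_conumerator_con_rec by blast
next
  fix c d
  assume "c \<in> extensional {0<..} \<and> is_conumerator c" "d \<in> extensional {0<..} \<and> is_conumerator d"
  then show "c = d"
    using is_conumerator_unique[of c d] by (auto intro: extensionalityI[of _ "{0<..}"])
qed

theorem is_conumerator_con: "is_conumerator con"
  using theI'[OF ex1_conumerator] by (simp add: con_def)

end

theory Submission
  imports Defs
begin

text \<open>Applying both functional equations to \<open>1 + Y\<close> shows that the values
  \<open>con (n + X)\<close> follow the Fibonacci recurrence in n, starting from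
  \<open>con X\<close> and \<open>con X + con (1 / X)\<close>; \<open>con_of_nat_plus\<close> solves
  it. The codenominator of \<open>1 + Z\<close> is \<open>con Z\<close>, so only n0 - 1 steps
  remain. Taking X = 1 / n1 leaves \<open>con (1 / n1)\<close> and \<open>con n1\<close>, themselves
  Fibonacci numbers.\<close>

lemma con_one: "con 1 = 1"
  using is_conumerator_con by (simp add: is_conumerator_def)

lemma con_one_plus: "X > 0 \<Longrightarrow> con (1 + X) = con X + con (1 / X)"
  using is_conumerator_con by (simp add: is_conumerator_def)

lemma con_inverse_one_plus: "X > 0 \<Longrightarrow> con (1 / (1 + X)) = con X"
  using is_conumerator_con by (simp add: is_conumerator_def)

text \<open>The two functional equations give the Fibonacci recurrence
  \<open>con (2 + Y) = con (1 + Y) + con Y\<close> for \<open>Y = n + X\<close>.\<close>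

lemma con_of_nat_plus:
  assumes "X > 0"
  shows "con (of_nat n + X) = fib (Suc n) * con X + fib n * con (1 / X)"
proof (induction n rule: fib.induct)
  case 1
  then show ?case by simp
next
  case 2
  then show ?case using con_one_plus[OF assms] by simp
next
  case (3 n)
  define Y where "Y = of_nat n + X"
  have pos: "Y > 0" "1 + Y > 0"
    using assms by (simp_all add: Y_def add_nonneg_pos)
  have "con (of_nat (Suc (Suc n)) + X) = con (1 + (1 + Y))"
    by (simp add: Y_def add.assoc)
  also have "\<dots> = con (of_nat (Suc n) + X) + con (of_nat n + X)"
    using con_one_plus[OF pos(2)] con_inverse_one_plus[OF pos(1)]
    by (simp add: Y_def add.assoc)
  finally show ?case
    using 3 by (simp add: algebra_simps)
qed

text \<open>Inverting \<open>1 + Z\<close> under \<open>con\<close> gives \<open>con Z\<close>; here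
  Z = n + X, which absorbs one unit.\<close>

lemma codenominator_of_nat_plus:
  assumes "X > 0"
  shows "codenominator (of_nat (Suc n) + X) = fib (Suc n) * con X + fib n * con (1 / X)"
proof -
  have "of_nat n + X > 0"
    using assms by (simp add: add_nonneg_pos)
  then show ?thesis
    using con_inverse_one_plus[of "of_nat n + X"] con_of_nat_plus[OF assms, of n]
    by (simp add: codenominator_def add.assoc)
qed

lemma con_of_nat:
  assumes "n > 0"
  shows "con (of_nat n) = fib (Suc n)"
proof -
  obtain m where "n = Suc m"
    using assms gr0_implies_Suc by blast
  \<comment> \<open>At X = 1 the two terms merge by the Fibonacci recurrence.\<close>
  then show ?thesis
    using con_of_nat_plus[of 1 m] by (simp add: con_one add.commute)
qed

text \<open>Writing n = 1 + m reduces this to \<open>con m\<close>. The functional equation requires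
  m > 0, so n = 1 is separate.\<close>

lemma con_inverse_of_nat:
  assumes "n > 0"
  shows "con (1 / of_nat n) = fib n"
proof (cases "n = 1")
  case True
  then show ?thesis by (simp add: con_one)
next
  case False
  then obtain m where m: "n = Suc m" "m > 0"
    using assms by (cases n) auto
  then show ?thesis
    using con_inverse_one_plus[of "of_nat m"] con_of_nat[of m] by simp
qed

theorem lemma3p1:
  fixes n0 n1 :: nat
  assumes "n0 > 0" and "n1 > 0"
  shows "codenominator (of_nat n0 + 1 / of_nat n1)
           = fib n0 * fib n1 + fib (n0 - 1) * fib (n1 + 1)"
proof -
  obtain m where m: "n0 = Suc m"
    using assms gr0_implies_Suc by blast
  show ?thesis
    using codenominator_of_nat_plus[of "1 / of_nat n1" m] assms
    by (simp add: m con_of_nat con_inverse_of_nat del: of_nat_Suc fib.simps)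
qed

end
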